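(* Let $k>0$, $H\in(1/2,1)$, $a\in\mathbb{R}$, $\sigma>0$, $Y_0>0$, and let $\{B^H_t,t\ge0\}$ be a fractional Brownian motion with Hurst index $H$. Then the process $Y=\{Y_t,t\ge0\}$ satisfying, until its first hitting of zero, the equation $$dY_t=\frac{1}{2}\left(\frac{k}{Y_t}-aY_t\right)dt+\frac{\sigma}{2}\,dB_t^H$$ with initial value $Y_0$ is strictly positive almost surely; that is, almost surely $Y$ never hits zero: $\inf\{t>0:Y_t=0\}=\infty$.
   Context: A fractional Brownian motion with Hurst index $H\in(0,1)$ is a centered Gaussian process $\{B^H_t,t\ge0\}$ with $B^H_0=0$, covariance $\mathbb{E}B^H_tB^H_s=\frac12(t^{2H}+s^{2H}-|t-s|^{2H})$, and continuous paths. That $Y$ satisfies the equation until its first hitting of zero means: $Y$ has continuous paths and, with $\tau:=\inf\{t>0:Y_t=0\}$ (where $\inf\emptyset=\infty$), pathwise for all $0\le t<\tau$ one has $Y_t>0$ and $Y_t=Y_0+\frac12\int_0^t\left(\frac{k}{Y_s}-aY_s\right)ds+\frac{\sigma}{2}B_t^H$. *)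

theory Defs
  imports "HOL-Probability.Probability"
begin

text \<open>Real Gaussian random variables, with degenerate (almost surely constant) ones included, so
  that linear combinations of jointly Gaussian variables are always covered.\<close>

definition gaussian_rv :: "'a measure \<Rightarrow> ('a \<Rightarrow> real) \<Rightarrow> bool" where
  "gaussian_rv M X \<longleftrightarrow>
     X \<in> borel_measurable M \<and>
     ((\<exists>\<mu> s. s > 0 \<and> distributed M lborel X (normal_density \<mu> s)) \<or>
      (\<exists>\<mu>. AE \<omega> in M. X \<omega> = \<mu>))"

definition gaussian_process :: "'a measure \<Rightarrow> 'i set \<Rightarrow> ('i \<Rightarrow> 'a \<Rightarrow> real) \<Rightarrow> bool" where
  "gaussian_process M T X \<longleftrightarrow>
     (\<forall>S c. finite S \<and> S \<subseteq> T \<longrightarrow> gaussian_rv M (\<lambda>\<omega>. \<Sum>t\<in>S. c t * X t \<omega>))"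

text \<open>Processes on the half-line are functions on all of \<open>real\<close>, constrained only at
  nonnegative times.\<close>

definition fractional_brownian_motion ::
    "'a measure \<Rightarrow> real \<Rightarrow> (real \<Rightarrow> 'a \<Rightarrow> real) \<Rightarrow> bool" where
  "fractional_brownian_motion M H B \<longleftrightarrow>
     0 < H \<and> H < 1 \<and>
     gaussian_process M {0..} B \<and>
     (\<forall>t\<ge>0. (\<integral>\<omega>. B t \<omega> \<partial>M) = 0) \<and>
     (\<forall>\<omega>\<in>space M. B 0 \<omega> = 0) \<and>
     (\<forall>t\<ge>0. \<forall>s\<ge>0. (\<integral>\<omega>. B t \<omega> * B s \<omega> \<partial>M) =
        (t powr (2 * H) + s powr (2 * H) - \<bar>t - s\<bar> powr (2 * H)) / 2) \<and>
     (\<forall>\<omega>\<in>space M. continuous_on {0..} (\<lambda>t. B t \<omega>))"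

text \<open>The value is \<open>\<infinity>\<close> if the path has no zero at a positive time.\<close>

definition first_zero :: "(real \<Rightarrow> real) \<Rightarrow> ereal" where
  "first_zero y = Inf {ereal t | t. t > 0 \<and> y t = 0}"

text \<open>The integral equation is required strictly before the first zero only; afterwards the path
  is merely continuous. Before that time the integrand is continuous on \<open>{0..t}\<close>.\<close>

definition satisfies_until_zero ::
    "real \<Rightarrow> real \<Rightarrow> real \<Rightarrow> real \<Rightarrow> (real \<Rightarrow> real) \<Rightarrow> (real \<Rightarrow> real) \<Rightarrow> bool" where
  "satisfies_until_zero k a \<sigma> y0 b y \<longleftrightarrow>
     continuous_on {0..} y \<and>
     y 0 = y0 \<and>
     (\<forall>t\<ge>0. ereal t < first_zero y \<longrightarrow>
        y t > 0 \<and>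
        y t = y0 + (LBINT s:{0..t}. k / y s - a * y s) / 2 + \<sigma> / 2 * b t)"

end

theory Submission
  imports Defs
begin

text \<open>Why \<open>Y\<close> cannot reach zero. Close to zero the drift \<open>k / Y\<close> pushes upwards with a force
  that grows like \<open>1 / Y\<close>, while the noise moves only a little in a short time: since \<open>H > 1/2\<close>,
  almost every path of \<open>B\<close> is locally Hoelder continuous of some order \<open>\<gamma> > 1/2\<close>
  (\<open>fbm_locally_hoelder\<close>). The rest is an argument about a single such path
  (\<open>first_zero_infinite\<close>).

  Suppose the first zero is \<open>\<tau> < \<infinity>\<close>. For small \<open>\<epsilon> > 0\<close> let \<open>s\<close> be the last time before \<open>\<tau>\<close> with
  \<open>Y s = \<epsilon>\<close>, and put \<open>d = \<tau> - s\<close>. Between \<open>s\<close> and \<open>\<tau>\<close> the path stays below \<open>\<epsilon>\<close>, so the drift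
  \<open>(k / Y - a * Y) / 2\<close> is at least \<open>k / (4 * \<epsilon>)\<close>. To come down from \<open>\<epsilon>\<close> to \<open>0\<close> the noise has to
  compensate both the height and the drift, whence, with a Hoelder constant \<open>C\<close>,
  \<open>\<epsilon> + k * d / (4 * \<epsilon>) \<le> \<sigma> / 2 * C * d powr \<gamma>\<close>.
  By the inequality of arithmetic and geometric means the left-hand side is at least
  \<open>sqrt (k * d)\<close>, whatever \<open>\<epsilon>\<close> is. Hence \<open>d powr (\<gamma> - 1/2)\<close> is bounded below by a positive
  constant. But \<open>d\<close> tends to \<open>0\<close> with \<open>\<epsilon>\<close>, and \<open>\<gamma> > 1/2\<close>: a contradiction.

  Hoelder continuity of the paths comes from the Kolmogorov--Chentsov theorem
  (\<open>kolmogorov_chentsov\<close>). The increment \<open>B t - B s\<close> is centered Gaussian with variance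
  \<open>\<bar>t - s\<bar> powr (2 * H)\<close>, so its moment of order \<open>2 * m\<close> is a constant times
  \<open>\<bar>t - s\<bar> powr (2 * m * H)\<close>; letting \<open>m\<close> grow reaches every exponent below \<open>H\<close>. The theorem itself
  is obtained by controlling, with Markov's inequality and the Borel--Cantelli lemma, the increments
  between neighbouring dyadic points, and by chaining these (\<open>dyadic_chaining\<close>).\<close>

section \<open>Hoelder continuity from dyadic increments\<close>

text \<open>The Hoelder estimate is asked for nearby times only. Over a compact interval a larger constant
  would extend it to all pairs, but the small scale is all that chaining produces directly and all
  that the argument near the zero consumes.\<close>

definition locally_hoelder :: "real \<Rightarrow> (real \<Rightarrow> real) \<Rightarrow> bool" where
  "locally_hoelder \<gamma> f \<longleftrightarrow>
     (\<forall>T. \<exists>C \<delta>. 0 < \<delta> \<and>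
        (\<forall>s\<in>{0..T}. \<forall>t\<in>{0..T}. \<bar>t - s\<bar> < \<delta> \<longrightarrow> \<bar>f t - f s\<bar> \<le> C * \<bar>t - s\<bar> powr \<gamma>))"

definition dyadic_index :: "nat \<Rightarrow> real \<Rightarrow> nat" where
  "dyadic_index n t = nat \<lfloor>2 ^ n * t\<rfloor>"

definition dyadic_below :: "nat \<Rightarrow> real \<Rightarrow> real" where
  "dyadic_below n t = real (dyadic_index n t) / 2 ^ n"

lemma dyadic_index_bounds:
  assumes "t \<ge> 0"
  shows "real (dyadic_index n t) \<le> 2 ^ n * t" "2 ^ n * t < real (dyadic_index n t) + 1"
proof -
  have "real (dyadic_index n t) = of_int \<lfloor>2 ^ n * t\<rfloor>"
    using assms by (simp add: dyadic_index_def)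
  then show "real (dyadic_index n t) \<le> 2 ^ n * t" "2 ^ n * t < real (dyadic_index n t) + 1"
    by linarith+
qed

lemma dyadic_below_bounds:
  assumes "t \<ge> 0"
  shows "0 \<le> dyadic_below n t" "dyadic_below n t \<le> t" "t - dyadic_below n t < (1/2) ^ n"
proof -
  have "t < (real (dyadic_index n t) + 1) / 2 ^ n" "real (dyadic_index n t) / 2 ^ n \<le> t"
    using dyadic_index_bounds[OF assms, of n] by (simp_all add: field_simps)
  then show "0 \<le> dyadic_below n t" "dyadic_below n t \<le> t" "t - dyadic_below n t < (1/2) ^ n"
    by (simp_all add: dyadic_below_def add_divide_distrib power_one_over)
qed

lemma dyadic_below_tendsto:
  assumes "t \<ge> 0"
  shows "(\<lambda>n. dyadic_below n t) \<longlonglongrightarrow> t"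
proof -
  have "(\<lambda>n. t - dyadic_below n t) \<longlonglongrightarrow> 0"
  proof (rule tendsto_sandwich)
    show "\<forall>\<^sub>F n in sequentially. 0 \<le> t - dyadic_below n t"
      using dyadic_below_bounds(2)[OF assms] by simp
    show "\<forall>\<^sub>F n in sequentially. t - dyadic_below n t \<le> (1/2) ^ n"
      using dyadic_below_bounds(3)[OF assms] by (simp add: less_imp_le)
    show "(\<lambda>n. 0 :: real) \<longlonglongrightarrow> 0" by simp
    show "(\<lambda>n. (1/2 :: real) ^ n) \<longlonglongrightarrow> 0" by (rule LIMSEQ_power_zero) simp
  qed
  then have "(\<lambda>n. t - (t - dyadic_below n t)) \<longlonglongrightarrow> t - 0"
    by (intro tendsto_intros)
  then show ?thesis by simp
qed

text \<open>Passing to the next level either keeps the dyadic point below \<open>t\<close> or moves it to the next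
  point of the finer grid, so that consecutive approximations are at most neighbours.\<close>

lemma dyadic_index_Suc:
  assumes "t \<ge> 0"
  shows "dyadic_index (Suc n) t = 2 * dyadic_index n t
       \<or> dyadic_index (Suc n) t = Suc (2 * dyadic_index n t)"
  using dyadic_index_bounds[OF assms, of n] dyadic_index_bounds[OF assms, of "Suc n"]
  by auto

text \<open>Both \<open>s\<close> and \<open>t\<close> are joined to their level-\<open>n\<close> dyadic points by successive refinement. Each
  step of level \<open>i > n\<close> costs at most \<open>q ^ i\<close>, which sums to \<open>q ^ n * (q / (1 - q))\<close>; continuity
  carries the bound to the limit. As \<open>s\<close> and \<open>t\<close> are closer than one grid step, their level-\<open>n\<close>
  points coincide or are neighbours, which adds one more \<open>q ^ n\<close>.\<close>

lemma dyadic_chaining: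
  fixes f :: "real \<Rightarrow> real" and N :: nat
  assumes cont: "continuous_on {0..real N} f"
    and q: "0 < q" "q < 1"
    and grid: "\<And>n j. n \<ge> n0 \<Longrightarrow> j < N * 2 ^ n \<Longrightarrow>
        \<bar>f (real (Suc j) / 2 ^ n) - f (real j / 2 ^ n)\<bar> \<le> q ^ n"
    and st: "0 \<le> s" "s \<le> t" "t \<le> real N" "t - s < (1/2) ^ n" and n: "n \<ge> n0"
  shows "\<bar>f t - f s\<bar> \<le> (1 + 2 * (q / (1 - q))) * q ^ n"
proof -
  have step: "\<bar>f (real j / 2 ^ m) - f (real i / 2 ^ m)\<bar> \<le> q ^ m"
    if "j = i \<or> j = Suc i" "real j \<le> 2 ^ m * u" "u \<le> real N" "m \<ge> n0" for i j m u
  proof (cases "j = i")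
    case True
    then show ?thesis using q by simp
  next
    case False
    with that have j: "j = Suc i" by simp
    have "real j \<le> 2 ^ m * real N"
      by (rule order_trans[OF that(2)]) (simp add: that(3))
    then have "real j \<le> real (N * 2 ^ m)" by (simp add: mult.commute)
    then have "i < N * 2 ^ m" using j by (simp only: of_nat_le_iff)
    then show ?thesis unfolding j by (intro grid that)
  qed
  \<comment> \<open>The right-hand side is the closed form of the geometric sum of \<open>q ^ i\<close> over
    \<open>m < i \<le> m + k\<close>.\<close>
  have tail: "\<bar>f (dyadic_below (m + k) u) - f (dyadic_below m u)\<bar> 
      \<le> (q ^ m - q ^ (m + k)) * (q / (1 - q))"
    if "0 \<le> u" "u \<le> real N" "m \<ge> n0" for m k u
  proof (induction k)
    case 0
    then show ?case by simp
  next
    case (Suc k)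
    have same: "dyadic_below (m + k) u = real (2 * dyadic_index (m + k) u) / 2 ^ Suc (m + k)"
      by (simp add: dyadic_below_def)
    have "\<bar>f (dyadic_below (Suc (m + k)) u) - f (dyadic_below (m + k) u)\<bar> \<le> q ^ Suc (m + k)"
      unfolding same dyadic_below_def[of "Suc (m + k)"]
      using dyadic_index_bounds(1)[OF that(1), of "Suc (m + k)"]
        dyadic_index_Suc[OF that(1), of "m + k"] that
      by (intro step[where u = u]) simp_all
    also have "\<dots> = (q ^ (m + k) - q ^ Suc (m + k)) * (q / (1 - q))"
      using q by (simp add: field_simps)
    finally show ?case
      using Suc abs_triangle_ineq[of "f (dyadic_below (Suc (m + k)) u) - f (dyadic_below (m + k) u)"
          "f (dyadic_below (m + k) u) - f (dyadic_below m u)"]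
      by (simp add: left_diff_distrib diff_divide_distrib)
  qed
  have approx: "\<bar>f u - f (dyadic_below m u)\<bar> \<le> q ^ m * (q / (1 - q))"
    if "0 \<le> u" "u \<le> real N" "m \<ge> n0" for m u
  proof (rule LIMSEQ_le_const2)
    have "(\<lambda>k. dyadic_below (m + k) u) \<longlonglongrightarrow> u"
      using LIMSEQ_ignore_initial_segment[OF dyadic_below_tendsto[OF that(1)], of m]
      by (simp add: add.commute)
    moreover have "dyadic_below k u \<in> {0..real N}" for k
      using dyadic_below_bounds[OF that(1), of k] that(2) by auto
    ultimately have "(\<lambda>k. f (dyadic_below (m + k) u)) \<longlonglongrightarrow> f u"
      using that by (intro continuous_on_tendsto_compose[OF cont]) auto
    then show "(\<lambda>k. \<bar>f (dyadic_below (m + k) u) - f (dyadic_below m u)\<bar>)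
        \<longlonglongrightarrow> \<bar>f u - f (dyadic_below m u)\<bar>"
      by (intro tendsto_intros)
    have "(q ^ m - q ^ (m + k)) * (q / (1 - q)) \<le> q ^ m * (q / (1 - q))" for k
      using q by (intro mult_right_mono) auto
    then show "\<exists>K. \<forall>k\<ge>K. \<bar>f (dyadic_below (m + k) u) - f (dyadic_below m u)\<bar>
        \<le> q ^ m * (q / (1 - q))"
      using tail[OF that] order_trans by blast
  qed
  have t0: "0 \<le> t" "s \<le> real N" using st by auto
  have "2 ^ n * (t - s) < 1" using st(4) by (simp add: field_simps)
  moreover have "2 ^ n * s \<le> 2 ^ n * t" using st by simp
  ultimately have "real (dyadic_index n t) < real (dyadic_index n s) + 2"
      "real (dyadic_index n s) < real (dyadic_index n t) + 1"
    using dyadic_index_bounds[OF st(1), of n] dyadic_index_bounds[OF t0(1), of n]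
    unfolding right_diff_distrib by linarith+
  then have "dyadic_index n t = dyadic_index n s \<or> dyadic_index n t = Suc (dyadic_index n s)"
    by linarith
  then have "\<bar>f (dyadic_below n t) - f (dyadic_below n s)\<bar> \<le> q ^ n"
    unfolding dyadic_below_def
    using dyadic_index_bounds(1)[OF t0(1)] st n by (intro step[where u = t]) auto
  moreover have "(1 + 2 * (q / (1 - q))) * q ^ n = q ^ n + 2 * (q ^ n * (q / (1 - q)))"
    by (simp add: algebra_simps)
  ultimately show ?thesis
    using approx[OF st(1) t0(2) n] approx[OF t0(1) st(3) n] by linarith
qed

text \<open>With \<open>q = 2 powr - \<gamma>\<close>, a scale \<open>n\<close> with \<open>(1/2) ^ Suc n \<le> t - s < (1/2) ^ n\<close> turns the
  chaining bound \<open>q ^ n = ((1/2) ^ n) powr \<gamma>\<close> into a multiple of \<open>(t - s) powr \<gamma>\<close>.\<close>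

lemma locally_hoelder_if_dyadic:
  fixes f :: "real \<Rightarrow> real"
  assumes cont: "continuous_on {0..} f" and \<gamma>: "\<gamma> > 0"
    and grid: "\<And>N :: nat. \<forall>\<^sub>F n in sequentially. \<forall>j < N * 2 ^ n.
        \<bar>f (real (Suc j) / 2 ^ n) - f (real j / 2 ^ n)\<bar> \<le> (2 powr - \<gamma>) ^ n"
  shows "locally_hoelder \<gamma> f"
  unfolding locally_hoelder_def
proof
  fix T :: real
  define q where "q = (2 :: real) powr - \<gamma>"
  have q: "0 < q" "q < 1"
    using \<gamma> by (auto simp: q_def powr_minus_divide)
  define N where "N = nat \<lceil>T\<rceil>"
  have N: "T \<le> real N" by (simp add: N_def real_nat_ceiling_ge)
  obtain n0 where n0: "\<And>n j. n \<ge> n0 \<Longrightarrow> j < N * 2 ^ n \<Longrightarrow>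
        \<bar>f (real (Suc j) / 2 ^ n) - f (real j / 2 ^ n)\<bar> \<le> q ^ n"
    using grid[of N] unfolding q_def eventually_sequentially by blast
  define K where "K = 1 + 2 * (q / (1 - q))"
  have K: "K > 0" using q by (auto simp: K_def intro!: add_pos_nonneg)
  have ordered: "\<bar>f t - f s\<bar> \<le> (K * 2 powr \<gamma>) * \<bar>t - s\<bar> powr \<gamma>"
    if st: "0 \<le> s" "s < t" "t \<le> T" "t - s < (1/2) ^ n0" for s t
  proof -
    let ?k = "LEAST k. (1/2) ^ (Suc n0 + k) \<le> t - s"
    define n where "n = n0 + ?k"
    have ex: "\<exists>k. (1/2) ^ (Suc n0 + k) \<le> t - s"
    proof -
      obtain k where "(1/2) ^ k < t - s"
        using real_arch_pow_inv[of "t - s" "1/2"] st by auto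
      moreover have "(1/2 :: real) ^ (Suc n0 + k) \<le> (1/2) ^ k"
        by (rule power_decreasing) auto
      ultimately show ?thesis by (intro exI[of _ k]) linarith
    qed
    have n: "n \<ge> n0" "Suc n = Suc n0 + ?k" by (auto simp: n_def)
    have low: "(1/2) ^ Suc n \<le> t - s"
      unfolding n(2) by (rule LeastI_ex[OF ex])
    have up: "t - s < (1/2) ^ n"
    proof (cases ?k)
      case 0
      then show ?thesis using n st by simp
    next
      case (Suc k')
      then have "\<not> (1/2) ^ (Suc n0 + k') \<le> t - s" by (intro not_less_Least) simp
      then show ?thesis using n Suc by simp
    qed
    have "\<bar>f t - f s\<bar> \<le> K * q ^ n"
      unfolding K_def
    proof (rule dyadic_chaining[OF _ q n0 st(1) _ _ up n(1)])
      show "continuous_on {0..real N} f" using cont by (rule continuous_on_subset) auto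
    qed (use st N in auto)
    also have "q ^ n = ((1/2) ^ n) powr \<gamma>"
      by (simp add: q_def powr_minus_divide powr_power powr_divide power_one_over flip: powr_realpow powr_powr)
         (simp add: powr_powr mult.commute)
    also have "\<dots> \<le> (2 * (t - s)) powr \<gamma>"
      using low \<gamma> by (intro powr_mono2) auto
    also have "\<dots> = 2 powr \<gamma> * \<bar>t - s\<bar> powr \<gamma>"
      using st powr_mult[of 2 "t - s" \<gamma>] by simp
    finally show ?thesis using K by (simp add: mult.assoc)
  qed
  show "\<exists>C \<delta>. 0 < \<delta> \<and>
      (\<forall>s\<in>{0..T}. \<forall>t\<in>{0..T}. \<bar>t - s\<bar> < \<delta> \<longrightarrow> \<bar>f t - f s\<bar> \<le> C * \<bar>t - s\<bar> powr \<gamma>)"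
  proof (rule exI[of _ "K * 2 powr \<gamma>"], rule exI[of _ "(1/2) ^ n0"], intro conjI ballI impI)
    fix s t assume st: "s \<in> {0..T}" "t \<in> {0..T}" "\<bar>t - s\<bar> < (1/2) ^ n0"
    show "\<bar>f t - f s\<bar> \<le> K * 2 powr \<gamma> * \<bar>t - s\<bar> powr \<gamma>"
      using ordered[of s t] ordered[of t s] st
      by (cases s t rule: linorder_cases) (auto simp: abs_minus_commute)
  qed simp
qed

section \<open>The Kolmogorov--Chentsov theorem for continuous processes\<close>

text \<open>At level \<open>n\<close>, Markov's inequality bounds the probability that a given dyadic increment reaches
  \<open>2 powr (- \<gamma> * n)\<close> by \<open>K * 2 powr (p * \<gamma> * n) * 2 powr (- (1 + \<beta>) * n)\<close>. There are about
  \<open>2 ^ n\<close> increments per unit of time, so the level fails with probability of order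
  \<open>2 powr ((p * \<gamma> - \<beta>) * n)\<close>, which is summable. By Borel--Cantelli almost surely only finitely
  many levels fail.\<close>

theorem (in prob_space) kolmogorov_chentsov:
  fixes X :: "real \<Rightarrow> 'a \<Rightarrow> real" and p :: nat
  assumes [measurable]: "\<And>t. t \<ge> 0 \<Longrightarrow> X t \<in> borel_measurable M"
    and cont: "\<And>\<omega>. \<omega> \<in> space M \<Longrightarrow> continuous_on {0..} (\<lambda>t. X t \<omega>)"
    and int: "\<And>s t. 0 \<le> s \<Longrightarrow> 0 \<le> t \<Longrightarrow> integrable M (\<lambda>\<omega>. \<bar>X t \<omega> - X s \<omega>\<bar> ^ p)"
    and moment: "\<And>s t. 0 \<le> s \<Longrightarrow> 0 \<le> t \<Longrightarrow>
        expectation (\<lambda>\<omega>. \<bar>X t \<omega> - X s \<omega>\<bar> ^ p) \<le> K * \<bar>t - s\<bar> powr (1 + \<beta>)"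
    and \<gamma>: "\<gamma> > 0" "real p * \<gamma> < \<beta>"
  shows "AE \<omega> in M. locally_hoelder \<gamma> (\<lambda>t. X t \<omega>)"
proof -
  define q where "q = (2 :: real) powr - \<gamma>"
  have q: "q > 0" by (simp add: q_def)
  define E where "E n j = {\<omega> \<in> space M.
      q ^ n \<le> \<bar>X (real (Suc j) / 2 ^ n) \<omega> - X (real j / 2 ^ n) \<omega>\<bar>}" for n j :: nat
  have E_sets [measurable]: "E n j \<in> sets M" for n j
    unfolding E_def by measurable
  define r where "r = (2 :: real) powr (real p * \<gamma> - \<beta>)"
  have r: "0 < r" "r < 1"
    using \<gamma> by (auto simp: r_def powr_less_one)
  \<comment> \<open>The factor \<open>1/2\<close> in \<open>r / 2\<close> pays for the \<open>2 ^ n\<close> increments of level \<open>n\<close>.\<close>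
  have E_prob: "prob (E n j) \<le> K * (r / 2) ^ n" for n j
  proof (cases "p = 0")
    case True
    then have "1 \<le> K * \<bar>t - s\<bar> powr (1 + \<beta>)" if "0 \<le> s" "0 \<le> t" for s t
      using moment[OF that] by (simp add: prob_space)
    from this[of 0 0] show ?thesis by simp
  next
    case False
    let ?Z = "\<lambda>\<omega>. \<bar>X (real (Suc j) / 2 ^ n) \<omega> - X (real j / 2 ^ n) \<omega>\<bar>"
    have "E n j = {\<omega> \<in> space M. (q ^ n) ^ p \<le> ?Z \<omega> ^ p}"
      unfolding E_def using q False
      by (auto intro: power_mono dest: power_le_imp_le_base simp: power_mono_iff)
    also have "prob \<dots> \<le> expectation (\<lambda>\<omega>. ?Z \<omega> ^ p) / (q ^ n) ^ p"
      using q by (intro integral_Markov_inequality_measure[where A = "{}"] int) auto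
    also have "\<dots> \<le> K * \<bar>real (Suc j) / 2 ^ n - real j / 2 ^ n\<bar> powr (1 + \<beta>) / (q ^ n) ^ p"
      using q by (intro divide_right_mono moment) auto
    also have "real (Suc j) / 2 ^ n - real j / 2 ^ n = 2 powr - real n"
      by (simp add: powr_minus_divide powr_realpow diff_divide_distrib[symmetric])
    also have "K * \<bar>2 powr - real n\<bar> powr (1 + \<beta>) / (q ^ n) ^ p = K * (r / 2) ^ n"
    proof -
      have "(q ^ n) ^ p = 2 powr (- \<gamma> * real n * real p)"
        by (simp add: q_def powr_power mult_ac)
      moreover have "r / 2 = 2 powr (real p * \<gamma> - \<beta> - 1)"
        by (simp add: r_def powr_diff)
      then have "(r / 2) ^ n = 2 powr ((real p * \<gamma> - \<beta> - 1) * real n)"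
        by (simp add: powr_power mult.commute)
      moreover have "\<bar>2 powr - real n\<bar> powr (1 + \<beta>) = 2 powr (- real n * (1 + \<beta>))"
        by (simp add: powr_powr)
      moreover have "2 powr (- real n * (1 + \<beta>)) / 2 powr (- \<gamma> * real n * real p) =
          2 powr ((real p * \<gamma> - \<beta> - 1) * real n)"
        unfolding powr_diff[symmetric] by (simp add: algebra_simps)
      ultimately show ?thesis
        by (simp only: times_divide_eq_right[symmetric])
    qed
    finally show ?thesis .
  qed
  have "AE \<omega> in M. \<forall>N :: nat. \<forall>\<^sub>F n in sequentially. \<omega> \<in> space M - (\<Union>j<N * 2 ^ n. E n j)"
    unfolding AE_all_countable
  proof
    fix N :: nat
    show "AE \<omega> in M. \<forall>\<^sub>F n in sequentially. \<omega> \<in> space M - (\<Union>j<N * 2 ^ n. E n j)"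
    proof (rule borel_cantelli_AE1)
      have "prob (\<Union>j<N * 2 ^ n. E n j) \<le> (real N * K) * r ^ n" for n
      proof -
        have "prob (\<Union>j<N * 2 ^ n. E n j) \<le> (\<Sum>j<N * 2 ^ n. prob (E n j))"
          by (intro finite_measure_subadditive_finite) auto
        also have "\<dots> \<le> (\<Sum>j<N * 2 ^ n. K * (r / 2) ^ n)"
          by (intro sum_mono E_prob)
        also have "\<dots> = (real N * K) * r ^ n"
          by (simp add: power_divide)
        finally show ?thesis .
      qed
      then have bound: "norm (prob (\<Union>j<N * 2 ^ n. E n j)) \<le> (real N * K) * r ^ n" for n
        by (simp only: real_norm_def abs_of_nonneg[OF measure_nonneg])
      have "summable (\<lambda>n. (real N * K) * r ^ n)"
        using r by (intro summable_mult summable_geometric) auto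
      then show "summable (\<lambda>n. prob (\<Union>j<N * 2 ^ n. E n j))"
        by (rule summable_comparison_test'[where N = 0]) (rule bound)
    qed (auto simp: less_top[symmetric])
  qed
  then show ?thesis
  proof (rule AE_mp, intro AE_I2 impI)
    fix \<omega> assume \<omega>: "\<omega> \<in> space M"
      and ev: "\<forall>N :: nat. \<forall>\<^sub>F n in sequentially. \<omega> \<in> space M - (\<Union>j<N * 2 ^ n. E n j)"
    show "locally_hoelder \<gamma> (\<lambda>t. X t \<omega>)"
    proof (rule locally_hoelder_if_dyadic[OF cont[OF \<omega>] \<gamma>(1)])
      fix N :: nat
      show "\<forall>\<^sub>F n in sequentially. \<forall>j < N * 2 ^ n.
          \<bar>X (real (Suc j) / 2 ^ n) \<omega> - X (real j / 2 ^ n) \<omega>\<bar> \<le> (2 powr - \<gamma>) ^ n"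
        using ev[rule_format, of N] by eventually_elim (use \<omega> in \<open>auto simp: E_def q_def not_le intro: less_imp_le\<close>)
    qed
  qed
qed

section \<open>Increments of fractional Brownian motion\<close>

lemma (in prob_space) gaussian_rv_centered_moment:
  assumes X: "gaussian_rv M X"
    and mean: "expectation X = 0"
  shows "integrable M (\<lambda>\<omega>. X \<omega> ^ k)"
    and "expectation (\<lambda>\<omega>. X \<omega> ^ (2 * m)) =
      fact (2 * m) / (2 ^ m * fact m) * expectation (\<lambda>\<omega>. (X \<omega>)\<^sup>2) ^ m"
proof -
  have [measurable]: "X \<in> borel_measurable M"
    using X by (simp add: gaussian_rv_def)
  have "integrable M (\<lambda>\<omega>. X \<omega> ^ k) \<and> expectation (\<lambda>\<omega>. X \<omega> ^ (2 * m)) =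
      fact (2 * m) / (2 ^ m * fact m) * expectation (\<lambda>\<omega>. (X \<omega>)\<^sup>2) ^ m"
    using X unfolding gaussian_rv_def
  proof (elim conjE disjE exE)
    fix \<mu> s :: real
    assume s: "s > 0" and D: "distributed M lborel X (normal_density \<mu> s)"
    have \<mu>: "\<mu> = 0"
      using normal_distributed_expectation[OF s D] mean by simp
    have mom: "expectation (\<lambda>\<omega>. X \<omega> ^ (2 * m)) = fact (2 * m) / ((2 / s\<^sup>2) ^ m * fact m)" for m
      using integral_normal_moment_even[OF s, of 0 m] distributed_integral[OF D, of "\<lambda>x. x ^ (2 * m)"]
      by (simp add: \<mu>)
    have "integrable M (\<lambda>\<omega>. X \<omega> ^ k)"
      using integrable_normal_moment[OF s, of \<mu> k] distributed_integrable[OF D, of "\<lambda>x. x ^ k"]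
      by (simp add: \<mu>)
    moreover have "expectation (\<lambda>\<omega>. (X \<omega>)\<^sup>2) = s\<^sup>2"
      using mom[of 1] by simp
    ultimately show ?thesis
      using mom[of m] s by (simp add: power_divide)
  next
    fix \<mu> :: real
    assume ae: "AE \<omega> in M. X \<omega> = \<mu>"
    then have "expectation X = expectation (\<lambda>_. \<mu>)"
      by (intro integral_cong_AE) auto
    with mean have "\<mu> = 0" by (simp add: prob_space)
    with ae have ae: "AE \<omega> in M. X \<omega> = 0" by simp
    have moms: "expectation (\<lambda>\<omega>. X \<omega> ^ i) = 0 ^ i" for i
    proof -
      have "expectation (\<lambda>\<omega>. X \<omega> ^ i) = expectation (\<lambda>_. 0 ^ i)"
        using ae by (intro integral_cong_AE) auto
      then show ?thesis by (simp add: prob_space)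
    qed
    have "integrable M (\<lambda>\<omega>. X \<omega> ^ k) \<longleftrightarrow> integrable M (\<lambda>_. 0 ^ k :: real)"
      using ae by (intro integrable_cong_AE) auto
    then show ?thesis
      using moms[of "2 * m"] moms[of 2] by (cases "m = 0") (simp_all add: prob_space power_0_left)
  qed
  then show "integrable M (\<lambda>\<omega>. X \<omega> ^ k)"
    and "expectation (\<lambda>\<omega>. X \<omega> ^ (2 * m)) =
      fact (2 * m) / (2 ^ m * fact m) * expectation (\<lambda>\<omega>. (X \<omega>)\<^sup>2) ^ m"
    by auto
qed

lemma (in prob_space) fbm_increment:
  assumes B: "fractional_brownian_motion M H B" and st: "s \<ge> 0" "t \<ge> 0"
  shows "gaussian_rv M (\<lambda>\<omega>. B t \<omega> - B s \<omega>)"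
    and "expectation (\<lambda>\<omega>. B t \<omega> - B s \<omega>) = 0"
    and "expectation (\<lambda>\<omega>. (B t \<omega> - B s \<omega>)\<^sup>2) = \<bar>t - s\<bar> powr (2 * H)"
proof -
  have gp: "gaussian_rv M (\<lambda>\<omega>. \<Sum>t\<in>S. c t * B t \<omega>)" if "finite S" "S \<subseteq> {0..}" for S c
    using B that by (auto simp: fractional_brownian_motion_def gaussian_process_def)
  have mean: "expectation (B u) = 0" if "u \<ge> 0" for u
    using B that by (auto simp: fractional_brownian_motion_def)
  have cov: "expectation (\<lambda>\<omega>. B u \<omega> * B v \<omega>) = (u powr (2 * H) + v powr (2 * H) - \<bar>u - v\<bar> powr (2 * H)) / 2"
    if "u \<ge> 0" "v \<ge> 0" for u v
    using B that by (auto simp: fractional_brownian_motion_def)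
  have g1: "gaussian_rv M (B u)" if "u \<ge> 0" for u
    using gp[of "{u}" "\<lambda>_. 1"] that by simp
  have int: "integrable M (\<lambda>\<omega>. B u \<omega> ^ k)" if "u \<ge> 0" for u k
    using gaussian_rv_centered_moment(1)[OF g1[OF that] mean[OF that]] .
  have meas: "B u \<in> borel_measurable M" if "u \<ge> 0" for u
    using g1[OF that] by (simp add: gaussian_rv_def)
  show "gaussian_rv M (\<lambda>\<omega>. B t \<omega> - B s \<omega>)"
  proof (cases "s = t")
    case True
    then show ?thesis using gp[of "{}" "\<lambda>_. 0"] by simp
  next
    case False
    then show ?thesis
      using gp[of "{s, t}" "\<lambda>u. if u = t then 1 else -1"] st by simp
  qed
  have i1: "integrable M (B u)" if "u \<ge> 0" for u
    using int[OF that, of 1] by simp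
  show "expectation (\<lambda>\<omega>. B t \<omega> - B s \<omega>) = 0"
    using i1 mean st by simp
  have iprod: "integrable M (\<lambda>\<omega>. B u \<omega> * B v \<omega>)" if "u \<ge> 0" "v \<ge> 0" for u v
  proof (rule Bochner_Integration.integrable_bound)
    show "integrable M (\<lambda>\<omega>. (B u \<omega>)\<^sup>2 + (B v \<omega>)\<^sup>2)"
      using int that by (intro Bochner_Integration.integrable_add) auto
    show "(\<lambda>\<omega>. B u \<omega> * B v \<omega>) \<in> borel_measurable M"
      using meas that by (intro borel_measurable_times) auto
    have "norm (x * y) \<le> norm (x\<^sup>2 + y\<^sup>2)" for x y :: real
    proof -
      have "2 * \<bar>x * y\<bar> \<le> x\<^sup>2 + y\<^sup>2"
        using sum_squares_bound[of "\<bar>x\<bar>" "\<bar>y\<bar>"] by (simp add: abs_mult mult.assoc)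
      then show ?thesis
        using abs_ge_zero[of "x * y"] by simp
    qed
    then show "AE \<omega> in M. norm (B u \<omega> * B v \<omega>) \<le> norm ((B u \<omega>)\<^sup>2 + (B v \<omega>)\<^sup>2)"
      by simp
  qed
  have "expectation (\<lambda>\<omega>. (B t \<omega> - B s \<omega>)\<^sup>2) =
      expectation (\<lambda>\<omega>. (B t \<omega> * B t \<omega> - 2 * (B t \<omega> * B s \<omega>)) + B s \<omega> * B s \<omega>)"
    by (simp add: power2_diff power2_eq_square algebra_simps)
  also have "\<dots> = \<bar>t - s\<bar> powr (2 * H)"
    using iprod st
    by (subst Bochner_Integration.integral_add, simp_all add: cov abs_minus_commute)
       (simp add: field_simps)
  finally show "expectation (\<lambda>\<omega>. (B t \<omega> - B s \<omega>)\<^sup>2) = \<bar>t - s\<bar> powr (2 * H)" .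
qed

text \<open>The moment of order \<open>2 * m\<close> gives every Hoelder exponent below \<open>H - 1 / (2 * m)\<close>, so \<open>m\<close> is
  chosen large enough for this to exceed \<open>\<gamma>\<close>.\<close>

lemma (in prob_space) fbm_locally_hoelder:
  assumes B: "fractional_brownian_motion M H B" and \<gamma>: "0 < \<gamma>" "\<gamma> < H"
  shows "AE \<omega> in M. locally_hoelder \<gamma> (\<lambda>t. B t \<omega>)"
proof -
  obtain m :: nat where m: "1 < real m * (2 * (H - \<gamma>))"
    using ex_less_of_nat_mult[of "2 * (H - \<gamma>)" 1] \<gamma> by auto
  note inc = fbm_increment[OF B]
  note mom = gaussian_rv_centered_moment[OF inc(1,2)]
  show ?thesis
  proof (rule kolmogorov_chentsov[where p = "2 * m" and \<beta> = "2 * real m * H - 1"])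
    show "B t \<in> borel_measurable M" if "t \<ge> 0" for t
    proof -
      have "B 0 \<omega> = 0" if "\<omega> \<in> space M" for \<omega>
        using B that by (auto simp: fractional_brownian_motion_def)
      moreover have "(\<lambda>\<omega>. B t \<omega> - B 0 \<omega>) \<in> borel_measurable M"
        using inc(1)[of 0 t] that by (simp add: gaussian_rv_def)
      ultimately show ?thesis by (simp cong: measurable_cong)
    qed
    show "continuous_on {0..} (\<lambda>t. B t \<omega>)" if "\<omega> \<in> space M" for \<omega>
      using B that by (auto simp: fractional_brownian_motion_def)
    fix s t :: real assume st: "0 \<le> s" "0 \<le> t"
    show "integrable M (\<lambda>\<omega>. \<bar>B t \<omega> - B s \<omega>\<bar> ^ (2 * m))"
      using mom(1)[OF st st, of "2 * m"] by (simp add: power_even_abs)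
    have "expectation (\<lambda>\<omega>. \<bar>B t \<omega> - B s \<omega>\<bar> ^ (2 * m)) =
        fact (2 * m) / (2 ^ m * fact m) * (\<bar>t - s\<bar> powr (2 * H)) ^ m"
      using mom(2)[OF st st, of m] inc(3)[OF st] by (simp add: power_even_abs)
    also have "(\<bar>t - s\<bar> powr (2 * H)) ^ m = \<bar>t - s\<bar> powr (1 + (2 * real m * H - 1))"
      using m by (cases "m = 0"; cases "s = t") (auto simp: powr_power mult_ac)
    finally show "expectation (\<lambda>\<omega>. \<bar>B t \<omega> - B s \<omega>\<bar> ^ (2 * m)) \<le>
        fact (2 * m) / (2 ^ m * fact m) * \<bar>t - s\<bar> powr (1 + (2 * real m * H - 1))" by simp
  qed (use \<gamma> m in \<open>auto simp: algebra_simps\<close>)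
qed

section \<open>A Hoelder path of order above one half cannot drive the solution to zero\<close>

text \<open>The infimum defining the first zero is attained and positive: the nonnegative zeros form a
  closed set which does not contain \<open>0\<close>.\<close>

lemma first_zero_attained:
  assumes cont: "continuous_on {0..} y" and y0: "y 0 > 0" and fin: "first_zero y \<noteq> \<infinity>"
  obtains \<tau> where "\<tau> > 0" "y \<tau> = 0" "first_zero y = ereal \<tau>"
proof -
  define Z where "Z = {t \<in> {0..}. y t = 0}"
  have Z: "{ereal t | t. t > 0 \<and> y t = 0} = ereal ` Z"
  proof -
    have "t > 0 \<and> y t = 0 \<longleftrightarrow> t \<in> Z" for t
      using y0 by (cases "t = 0") (auto simp: Z_def)
    then show ?thesis by (simp add: Setcompr_eq_image)
  qed
  have "Z \<noteq> {}"
    using fin unfolding first_zero_def Z by (metis Inf_empty image_empty top_ereal_def)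
  moreover have bdd: "bdd_below Z"
    by (auto simp: Z_def intro!: bdd_belowI[of _ 0])
  moreover have "closed Z"
    unfolding Z_def by (intro continuous_closed_preimage_constant cont) simp
  ultimately have mem: "Inf Z \<in> Z"
    by (rule closed_contains_Inf)
  have "first_zero y = ereal (Inf Z)"
    unfolding first_zero_def Z
    by (rule Inf_eqI) (use mem in \<open>auto intro: cInf_lower[OF _ bdd]\<close>)
  moreover have "Inf Z > 0"
    using mem y0 by (cases "Inf Z = 0") (simp_all add: Z_def)
  ultimately show ?thesis
    using mem that[of "Inf Z"] by (simp add: Z_def)
qed

text \<open>The pathwise core. The order of choices matters: the threshold \<open>\<eta>\<close> for the time span depends
  only on \<open>k\<close>, \<open>\<sigma>\<close>, \<open>\<tau>\<close> and the Hoelder data, and \<open>\<epsilon>\<close> is taken afterwards, below the minimum of the path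
  on \<open>{0..\<tau> - \<eta>}\<close>. This places the last passage through \<open>\<epsilon>\<close> within \<open>\<eta>\<close> of the zero, where the
  noise is too weak.\<close>

lemma first_zero_infinite:
  assumes k: "k > 0" and y0: "y0 > 0" and \<sigma>: "\<sigma> > 0"
    and sol: "satisfies_until_zero k a \<sigma> y0 b y"
    and hoelder: "locally_hoelder \<gamma> b" and \<gamma>: "\<gamma> > 1/2"
  shows "first_zero y = \<infinity>"
proof (rule ccontr)
  have cont: "continuous_on {0..} y" and init: "y 0 = y0"
    using sol by (auto simp: satisfies_until_zero_def)
  assume "first_zero y \<noteq> \<infinity>"
  then obtain \<tau> where \<tau>: "\<tau> > 0" "y \<tau> = 0" and fz: "first_zero y = ereal \<tau>"
    using first_zero_attained[OF cont] init y0 by metis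
  have pos: "y t > 0" and eq: "y t = y0 + (LBINT s:{0..t}. k / y s - a * y s) / 2 + \<sigma> / 2 * b t"
    if "0 \<le> t" "t < \<tau>" for t
    using sol that unfolding satisfies_until_zero_def fz less_ereal.simps by blast+
  obtain C0 \<delta> where \<delta>: "0 < \<delta>"
    and C0: "\<And>s t. s \<in> {0..\<tau>} \<Longrightarrow> t \<in> {0..\<tau>} \<Longrightarrow> \<bar>t - s\<bar> < \<delta> \<Longrightarrow> \<bar>b t - b s\<bar> \<le> C0 * \<bar>t - s\<bar> powr \<gamma>"
    using hoelder unfolding locally_hoelder_def by metis
  define C where "C = \<bar>C0\<bar> + 1"
  have C: "C > 0" by (simp add: C_def)
  have hoeld: "b t - b s \<le> C * \<bar>t - s\<bar> powr \<gamma>"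
    if "s \<in> {0..\<tau>}" "t \<in> {0..\<tau>}" "\<bar>t - s\<bar> < \<delta>" for s t
  proof -
    have "C0 * \<bar>t - s\<bar> powr \<gamma> \<le> C * \<bar>t - s\<bar> powr \<gamma>"
      by (intro mult_right_mono) (auto simp: C_def)
    then show ?thesis using C0[OF that] abs_ge_self[of "b t - b s"] by linarith
  qed
  \<comment> \<open>The descent will force \<open>c \<le> d powr (\<gamma> - 1/2)\<close>, whereas \<open>d < \<eta>\<close> gives the opposite.\<close>
  define c where "c = sqrt k / (\<sigma> / 2 * C)"
  have c: "c > 0" using k \<sigma> C by (simp add: c_def)
  define \<eta> where "\<eta> = min (min \<delta> \<tau>) (c powr (1 / (\<gamma> - 1/2)))"
  have \<eta>: "0 < \<eta>" "\<eta> \<le> \<delta>" "\<eta> \<le> \<tau>" "\<eta> \<le> c powr (1 / (\<gamma> - 1/2))"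
    using \<delta> \<tau> c by (auto simp: \<eta>_def)
  obtain m where m: "m > 0" "\<And>t. t \<in> {0..\<tau> - \<eta>} \<Longrightarrow> m \<le> y t"
  proof -
    have "\<exists>x\<in>{0..\<tau> - \<eta>}. \<forall>t\<in>{0..\<tau> - \<eta>}. y x \<le> y t"
      using \<eta> by (intro continuous_attains_inf continuous_on_subset[OF cont]) auto
    then obtain x where "x \<in> {0..\<tau> - \<eta>}" "\<And>t. t \<in> {0..\<tau> - \<eta>} \<Longrightarrow> y x \<le> y t" by blast
    then show ?thesis using pos[of x] \<eta> by (intro that[of "y x"]) auto
  qed
  \<comment> \<open>The second bound makes the linear term harmless: below \<open>\<epsilon>\<close> it consumes at most half of the
    singular drift \<open>k / \<epsilon>\<close>.\<close>
  define \<epsilon> where "\<epsilon> = min (m / 2) (sqrt (k / (2 * (\<bar>a\<bar> + 1))))"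
  have \<epsilon>: "\<epsilon> > 0" "\<epsilon> < m" using m k by (auto simp: \<epsilon>_def)
  have "\<epsilon>\<^sup>2 \<le> (sqrt (k / (2 * (\<bar>a\<bar> + 1))))\<^sup>2"
    using \<epsilon> by (intro power_mono) (auto simp: \<epsilon>_def)
  also have "\<dots> = k / (2 * (\<bar>a\<bar> + 1))" using k by simp
  finally have "\<epsilon>\<^sup>2 * (\<bar>a\<bar> + 1) \<le> k / 2"
    by (simp add: field_simps)
  moreover have "\<epsilon>\<^sup>2 * (\<bar>a\<bar> + 1) = \<bar>a\<bar> * \<epsilon>\<^sup>2 + \<epsilon>\<^sup>2" by algebra
  ultimately have a\<epsilon>: "\<bar>a\<bar> * \<epsilon>\<^sup>2 \<le> k / 2"
    using zero_le_power2[of \<epsilon>] by linarith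
  \<comment> \<open>The supremum of \<open>S\<close> is the last time before \<open>\<tau>\<close> at which the level \<open>\<epsilon>\<close> is taken.\<close>
  define S where "S = {t \<in> {0..\<tau>}. \<epsilon> \<le> y t}"
  have "closed S"
    unfolding S_def
    by (intro continuous_closed_preimage[of _ _ "{\<epsilon>..}", simplified vimage_def Int_def, simplified]
        continuous_on_subset[OF cont]) auto
  moreover have "S \<noteq> {}" 
    using m(2)[of 0] \<epsilon> \<eta> \<tau> by (auto simp: S_def intro!: exI[of _ 0])
  moreover have bdd: "bdd_above S" by (auto simp: S_def)
  ultimately have Sup: "Sup S \<in> S" by (intro closed_contains_Sup)
  define s where "s = Sup S"
  have s: "0 \<le> s" "s < \<tau>" "\<epsilon> \<le> y s"
    using Sup \<epsilon> \<tau> by (auto simp: s_def S_def order_le_less)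
  have after: "y t < \<epsilon>" if "s < t" "t \<le> \<tau>" for t
    using cSup_upper[OF _ bdd, of t] that s by (auto simp: s_def S_def not_le[symmetric])
  have ys: "y s = \<epsilon>"
  proof -
    obtain u where "s \<le> u" "u \<le> \<tau>" "y u = \<epsilon>"
      using IVT2'[of y \<tau> \<epsilon> s] s \<epsilon> \<tau> continuous_on_subset[OF cont, of "{s..\<tau>}"] by auto
    then show ?thesis using after[of u] by (cases "s = u") auto
  qed
  have s\<eta>: "\<tau> - s < \<eta>"
    using m(2)[of s] \<epsilon> s ys by (force simp: not_less)
  define \<kappa> where "\<kappa> = k / (2 * \<epsilon>)"
  have drift: "\<kappa> \<le> k / y t - a * y t" if "t \<in> {s..<\<tau>}" for t
  proof -
    have yt: "0 < y t" "y t \<le> \<epsilon>"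
      using that s pos[of t] after[of t] ys by (cases "s = t"; force)+
    have "a * y t \<le> \<bar>a\<bar> * \<epsilon>" using yt by (intro mult_mono) auto
    also have "\<dots> \<le> k / (2 * \<epsilon>)"
      using a\<epsilon> \<epsilon> by (simp add: field_simps power2_eq_square)
    finally have "a * y t \<le> \<kappa>" by (simp add: \<kappa>_def)
    moreover have "k / \<epsilon> \<le> k / y t" using yt k by (intro divide_left_mono) auto
    moreover have "k / \<epsilon> = 2 * \<kappa>" by (simp add: \<kappa>_def)
    ultimately show ?thesis by linarith
  qed
  let ?g = "\<lambda>t. k / y t - a * y t"
  let ?h = "\<lambda>u. \<kappa> / 2 * (u - s) + y s - y u - \<sigma> / 2 * C * \<bar>u - s\<bar> powr \<gamma>"
  have before: "?h u \<le> 0" if u: "u \<in> {s..<\<tau>}" for u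
  proof -
    have contg: "continuous_on {0..u} ?g"
      using u pos by (intro continuous_intros continuous_on_subset[OF cont]) force+
    have I: "(LBINT v:{0..w}. ?g v) = integral {0..w} ?g" if "w \<le> u" for w
      using that by (intro set_borel_integral_eq_integral borel_integrable_atLeastAtMost'
        continuous_on_subset[OF contg]) auto
    have intu: "?g integrable_on {0..u}"
      using contg by (rule integrable_continuous_real)
    have "integral {0..s} ?g + integral {s..u} ?g = integral {0..u} ?g"
      using s u intu by (intro Henstock_Kurzweil_Integration.integral_combine) auto
    moreover have "\<kappa> * (u - s) \<le> integral {s..u} ?g"
    proof -
      have "integral {s..u} (\<lambda>_. \<kappa>) \<le> integral {s..u} ?g"
        using u drift s by (intro integral_le integrable_subinterval_real[OF intu]) auto
      then show ?thesis using u by (simp add: mult.commute)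
    qed
    moreover have "y u - y s = (integral {0..u} ?g - integral {0..s} ?g) / 2 + \<sigma> / 2 * (b u - b s)"
      using eq[of u] eq[of s] I[of u] I[of s] s u by (simp add: field_simps)
    moreover have "\<sigma> / 2 * (b s - b u) \<le> \<sigma> / 2 * (C * \<bar>u - s\<bar> powr \<gamma>)"
      using hoeld[of u s] \<sigma> s u s\<eta> \<eta> by (intro mult_left_mono) (auto simp: abs_minus_commute)
    ultimately show ?thesis by (simp add: field_simps)
  qed
  \<comment> \<open>The equation is available strictly before \<open>\<tau>\<close> only; continuity extends the estimate
    to \<open>\<tau>\<close>.\<close>
  have "?h \<tau> \<le> 0"
  proof (rule continuous_le_on_closure[where f = ?h and S = "{s..<\<tau>}"])
    have cl: "closure {s..<\<tau>} = {s..\<tau>}" using s by simp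
    show "continuous_on (closure {s..<\<tau>}) ?h"
      unfolding cl using s \<gamma>
      by (intro continuous_intros continuous_on_powr' continuous_on_subset[OF cont]) auto
    show "\<tau> \<in> closure {s..<\<tau>}" using cl s by simp
  qed (rule before)
  define d where "d = \<tau> - s"
  have d: "0 < d" "d < \<eta>" using s s\<eta> by (auto simp: d_def)
  have "\<epsilon> + \<kappa> / 2 * d \<le> \<sigma> / 2 * C * d powr \<gamma>"
    using \<open>?h \<tau> \<le> 0\<close> ys \<tau> s by (simp add: d_def)
  moreover have "sqrt (k * d) \<le> \<epsilon> + \<kappa> / 2 * d"
  proof -
    have "sqrt (k * d) = 2 * sqrt (\<epsilon> * (\<kappa> / 2 * d))"
      using \<epsilon> by (simp add: \<kappa>_def real_sqrt_divide)
    then show ?thesis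
      using arith_geo_mean_sqrt[of \<epsilon> "\<kappa> / 2 * d"] \<epsilon> d k by (simp add: \<kappa>_def)
  qed
  ultimately have "sqrt k * sqrt d \<le> \<sigma> / 2 * C * d powr \<gamma>"
    by (simp add: real_sqrt_mult)
  also have "d powr \<gamma> = d powr (\<gamma> - 1/2) * sqrt d"
    using d by (simp add: powr_half_sqrt[symmetric] powr_add[symmetric])
  finally have "sqrt k \<le> \<sigma> / 2 * C * d powr (\<gamma> - 1/2)"
    using d by (simp add: mult.assoc[symmetric])
  then have "c \<le> d powr (\<gamma> - 1/2)"
    using \<sigma> C by (simp add: c_def field_simps)
  moreover have "d powr (\<gamma> - 1/2) < (c powr (1 / (\<gamma> - 1/2))) powr (\<gamma> - 1/2)"
    using d \<eta> \<gamma> by (intro powr_less_mono2) auto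
  moreover have "\<dots> = c"
    using c \<gamma> by (simp add: powr_powr)
  ultimately show False by simp
qed

theorem theorem2:
  fixes M :: "'a measure"
    and k H a \<sigma> y0 :: real
    and B Y :: "real \<Rightarrow> 'a \<Rightarrow> real"
  assumes "prob_space M"
    and "k > 0"
    and "1 / 2 < H" and "H < 1"
    and "\<sigma> > 0"
    and "y0 > 0"
    and "fractional_brownian_motion M H B"
    and "\<And>t. t \<ge> 0 \<Longrightarrow> Y t \<in> borel_measurable M"
    and "\<And>\<omega>. \<omega> \<in> space M \<Longrightarrow>
           satisfies_until_zero k a \<sigma> y0 (\<lambda>t. B t \<omega>) (\<lambda>t. Y t \<omega>)"
  shows "AE \<omega> in M. first_zero (\<lambda>t. Y t \<omega>) = \<infinity> \<and> (\<forall>t\<ge>0. Y t \<omega> > 0)"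
proof -
  interpret prob_space M by fact
  \<comment> \<open>Any exponent strictly between \<open>1/2\<close> and \<open>H\<close> serves.\<close>
  define \<gamma> where "\<gamma> = (1/2 + H) / 2"
  have \<gamma>: "1/2 < \<gamma>" "\<gamma> < H" using assms(3) by (auto simp: \<gamma>_def)
  have "AE \<omega> in M. locally_hoelder \<gamma> (\<lambda>t. B t \<omega>)"
    using \<gamma> by (intro fbm_locally_hoelder[OF assms(7)]) auto
  then show ?thesis
  proof (rule AE_mp, intro AE_I2 impI)
    fix \<omega> assume \<omega>: "\<omega> \<in> space M" and h: "locally_hoelder \<gamma> (\<lambda>t. B t \<omega>)"
    have "first_zero (\<lambda>t. Y t \<omega>) = \<infinity>"
      by (rule first_zero_infinite[OF assms(2,6,5) assms(9)[OF \<omega>] h \<gamma>(1)])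
    moreover have "Y t \<omega> > 0" if "t \<ge> 0" "ereal t < first_zero (\<lambda>t. Y t \<omega>)" for t
      using assms(9)[OF \<omega>] that unfolding satisfies_until_zero_def by blast
    ultimately show "first_zero (\<lambda>t. Y t \<omega>) = \<infinity> \<and> (\<forall>t\<ge>0. Y t \<omega> > 0)"
      by simp
  qed
qed

end
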